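(* There exists a label-invariant property $\mathcal{P}$ of distributions over $[n]$ and a constant proximity parameter $\epsilon>0$ such that any (possibly randomized, adaptive) tester that, given $\mathsf{COND}$ query access to an unknown distribution $D$ over $[n]$, accepts with probability at least $2/3$ if $D$ has property $\mathcal{P}$ and rejects with probability at least $2/3$ if $D$ is $\epsilon$-far in total variation distance from every distribution having $\mathcal{P}$, must make $\tilde{\Omega}(\log\log n)$ $\mathsf{COND}$ queries, where $\tilde{\Omega}$ hides a $\mathrm{poly}(\log\log\log n)$ factor.
   Context: A property of distributions over $[n]$ is a set of distributions; it is label-invariant if it is closed under relabeling of the domain, i.e., under $D\mapsto D\circ\pi$ for every permutation $\pi$ of $[n]$. Total variation distance: $d_{TV}(D_1,D_2)=\frac12\sum_{s\in[n]}|D_1(s)-D_2(s)|$; $D$ is $\epsilon$-far from $\mathcal{P}$ if $d_{TV}(D,D')\ge\epsilon$ for all $D'\in\mathcal{P}$. For $A\subseteq[n]$ with $D(A)=\sum_{a\in A}D(a)$, the conditional distribution $D|_A$ puts mass $D(a)/D(A)$ on $a\in A$ if $D(A)>0$ and is uniform on $A$ otherwise. A $\mathsf{COND}$ query consists of choosing any subset $A\subseteq[n]$ (possibly depending on previous answers) and receiving a sample from $D|_A$. *)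

theory Defs
  imports "HOL-Probability.Probability" "HOL-Combinatorics.Permutations"
begin

definition dists :: "nat \<Rightarrow> nat pmf set" where
  "dists n = {D. set_pmf D \<subseteq> {1..n}}"

text \<open>A property is given as a family indexed by the domain size. The distribution
  \<^term>\<open>map_pmf (inv \<pi>) D\<close> is \<open>D \<circ> \<pi>\<close>; see \<open>pmf_relabel\<close> below.\<close>

definition label_invariant :: "(nat \<Rightarrow> nat pmf set) \<Rightarrow> bool" where
  "label_invariant P \<longleftrightarrow>
     (\<forall>n. P n \<subseteq> dists n \<and>
          (\<forall>D \<in> P n. \<forall>\<pi>. \<pi> permutes {1..n} \<longrightarrow> map_pmf (inv \<pi>) D \<in> P n))"

lemma pmf_relabel:
  assumes "\<pi> permutes {1..n}"
  shows "pmf (map_pmf (inv \<pi>) D) x = pmf D (\<pi> x)"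
proof -
  have "inj (inv \<pi>)" "inv \<pi> (\<pi> x) = x"
    using permutes_inj[OF permutes_inv[OF assms]] permutes_inverses(2)[OF assms] by auto
  then show ?thesis
    by (metis pmf_map_inj')
qed

definition d_TV :: "nat \<Rightarrow> nat pmf \<Rightarrow> nat pmf \<Rightarrow> real" where
  "d_TV n D1 D2 = 1/2 * (\<Sum>s\<in>{1..n}. \<bar>pmf D1 s - pmf D2 s\<bar>)"

definition far_from :: "nat \<Rightarrow> real \<Rightarrow> nat pmf \<Rightarrow> nat pmf set \<Rightarrow> bool" where
  "far_from n \<epsilon> D Q \<longleftrightarrow> (\<forall>D'\<in>Q. d_TV n D D' \<ge> \<epsilon>)"

definition cond_dist :: "nat pmf \<Rightarrow> nat set \<Rightarrow> nat pmf" where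
  "cond_dist D A = (if measure_pmf.prob D A > 0 then cond_pmf D A else pmf_of_set A)"

lemma pmf_cond_dist:
  assumes "finite A" "A \<noteq> {}"
  shows "pmf (cond_dist D A) a =
    (if a \<in> A then (if (\<Sum>x\<in>A. pmf D x) > 0 then pmf D a / (\<Sum>x\<in>A. pmf D x)
                   else 1 / card A)
     else 0)"
proof -
  have D: "measure_pmf.prob D A = (\<Sum>x\<in>A. pmf D x)"
    using assms(1) by (rule measure_measure_pmf_finite)
  have "set_pmf D \<inter> A \<noteq> {}" if "measure_pmf.prob D A > 0"
    using that measure_pmf_zero_iff[of D A] by auto
  then show ?thesis
    using assms by (auto simp: cond_dist_def D pmf_cond pmf_of_set indicator_def)
qed

text \<open>A randomized adaptive algorithm with query access to a distribution is an interaction tree: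
  it stops and accepts (\<^term>\<open>True\<close>) or rejects (\<^term>\<open>False\<close>), or queries a set and continues
  depending on the answer, or tosses coins to choose how to continue. Each node may depend on all
  earlier answers and coins.\<close>

datatype tester =
    Decide bool
  | Query "nat set" "nat \<Rightarrow> tester"
  | Toss "tester pmf"

primrec run :: "nat pmf \<Rightarrow> tester \<Rightarrow> bool pmf" where
  "run D (Decide b) = return_pmf b"
| "run D (Query A k) = bind_pmf (cond_dist D A) (\<lambda>a. run D (k a))"
| "run D (Toss p) = join_pmf (map_pmf (run D) p)"

text \<open>All queries of the tester are nonempty subsets of \<open>{1..n}\<close>, and every execution makes at most
  \<open>q\<close> of them. Only answers in the queried set count. Every path following such answers is taken
  with positive probability when the unknown distribution is uniform on \<open>{1..n}\<close>, so this is
  the worst case over distributions and coins.\<close>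

inductive queries_le :: "nat \<Rightarrow> nat \<Rightarrow> tester \<Rightarrow> bool" for n where
  "queries_le n q (Decide b)"
| "A \<noteq> {} \<Longrightarrow> A \<subseteq> {1..n} \<Longrightarrow> (\<forall>a\<in>A. queries_le n q (k a)) \<Longrightarrow> queries_le n (Suc q) (Query A k)"
| "(\<forall>t\<in>set_pmf p. queries_le n q t) \<Longrightarrow> queries_le n q (Toss p)"

definition tests_property :: "nat \<Rightarrow> nat pmf set \<Rightarrow> real \<Rightarrow> tester \<Rightarrow> bool" where
  "tests_property n Q \<epsilon> t \<longleftrightarrow>
     (\<forall>D \<in> dists n.
        (D \<in> Q \<longrightarrow> pmf (run D t) True \<ge> 2/3) \<and>
        (far_from n \<epsilon> D Q \<longrightarrow> pmf (run D t) False \<ge> 2/3))"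

end

theory Submission
  imports Defs "HOL-Real_Asymp.Real_Asymp"
begin

text \<open>The property consists of the uniform distributions on sets whose size is within a factor 2 of
  \<open>g ^ (i + 1)\<close> for an even \<open>i\<close>; the same with an odd \<open>i\<close> is far from it. Let the unknown distribution
  be uniform on a random set \<open>S\<close> that contains each point independently with probability
  \<open>p\<^sub>i = g ^ (i + 1) / n\<close>, where \<open>0 \<le> i \<le> m\<close> and \<open>m\<close> is about \<open>sqrt (ln n)\<close>. The acceptance probability
  of a correct tester then jumps by a constant between any two consecutive scales, so that its
  total variation along \<open>i\<close> is at least of order \<open>m\<close>.

  Conversely, a tester with \<open>q\<close> queries has variation less than \<open>3 * 2 ^ q\<close>. Suppose that the set
  \<open>K\<close> of points is already known to lie in \<open>S\<close>, and \<open>A\<close> is queried. If \<open>p\<^sub>i * card (A - K)\<close> is small,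
  then most likely no unknown point of \<open>A\<close> lies in \<open>S\<close>, and the answer carries no information. If it
  is large, then the answer is nearly uniform on \<open>A - K\<close>, and conditioning on it only adds the
  answer to \<open>K\<close>. As \<open>g\<close> is large, all but one \<open>i\<close> fall under one of the two cases, each of which
  continues with one query less; hence the variation at most doubles, up to an additive constant.
  It follows that \<open>q\<close> is at least of order \<open>ln m\<close>, even without a correction factor.\<close>

section \<open>Averages over random subsets\<close>

text \<open>Expectation over a random subset of \<open>V\<close> that contains each point independently with
  probability \<open>p\<close>.\<close>

definition subset_mean :: "'a set \<Rightarrow> real \<Rightarrow> ('a set \<Rightarrow> real) \<Rightarrow> real" where
  "subset_mean V p f = (\<Sum>R\<in>Pow V. p ^ card R * (1 - p) ^ card (V - R) * f R)"

lemma subset_mean_cong: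
  "(\<And>R. R \<subseteq> V \<Longrightarrow> f R = g R) \<Longrightarrow> subset_mean V p f = subset_mean V p g"
  unfolding subset_mean_def by (rule sum.cong) auto

lemma subset_mean_mono:
  assumes "0 \<le> p" "p \<le> 1" "\<And>R. R \<subseteq> V \<Longrightarrow> f R \<le> g R"
  shows "subset_mean V p f \<le> subset_mean V p g"
  unfolding subset_mean_def using assms by (intro sum_mono mult_left_mono) auto

lemma subset_mean_add:
  "subset_mean V p (\<lambda>R. f R + g R) = subset_mean V p f + subset_mean V p g"
  unfolding subset_mean_def by (simp add: algebra_simps sum.distrib)

lemma subset_mean_diff:
  "subset_mean V p (\<lambda>R. f R - g R) = subset_mean V p f - subset_mean V p g"
  unfolding subset_mean_def by (simp add: algebra_simps sum_subtractf)

lemma subset_mean_cmult: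
  "subset_mean V p (\<lambda>R. c * f R) = c * subset_mean V p f"
  unfolding subset_mean_def by (simp add: algebra_simps sum_distrib_left)

lemma subset_mean_divide:
  "subset_mean V p (\<lambda>R. f R / c) = subset_mean V p f / c"
  using subset_mean_cmult[of V p "1 / c" f] by simp

lemma subset_mean_sum:
  "subset_mean V p (\<lambda>R. \<Sum>a\<in>B. f a R) = (\<Sum>a\<in>B. subset_mean V p (f a))"
  unfolding subset_mean_def by (simp add: sum_distrib_left) (rule sum.swap)

text \<open>The subsets of \<open>insert a V\<close> split into those without \<open>a\<close> and
  those with it, which carry weights \<open>1 - p\<close> and \<open>p\<close>.\<close>

lemma subset_mean_insert:
  assumes "finite V" "a \<notin> V"
  shows "subset_mean (insert a V) p f =
    (1 - p) * subset_mean V p f + p * subset_mean V p (\<lambda>R. f (insert a R))"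
proof -
  let ?w = "\<lambda>R. p ^ card R * (1 - p) ^ card (insert a V - R) * f R"
  have 1: "sum ?w (Pow V) = (1 - p) * subset_mean V p f"
    unfolding subset_mean_def sum_distrib_left
  proof (rule sum.cong)
    fix R assume "R \<in> Pow V"
    then have "insert a V - R = insert a (V - R)" "a \<notin> V - R" "finite (V - R)"
      using assms by auto
    then show "?w R = (1 - p) * (p ^ card R * (1 - p) ^ card (V - R) * f R)" by simp
  qed simp
  have "inj_on (insert a) (Pow V)"
    using assms by (auto simp: inj_on_def)
  then have "sum ?w (insert a ` Pow V) = (\<Sum>R\<in>Pow V. ?w (insert a R))"
    by (simp add: sum.reindex)
  also have "\<dots> = p * subset_mean V p (\<lambda>R. f (insert a R))"
    unfolding subset_mean_def sum_distrib_left
  proof (rule sum.cong)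
    fix R assume "R \<in> Pow V"
    then have "insert a V - insert a R = V - R" "a \<notin> R" "finite R"
      using assms finite_subset by auto
    then show "?w (insert a R) = p * (p ^ card R * (1 - p) ^ card (V - R) * f (insert a R))"
      by simp
  qed simp
  finally have 2: "sum ?w (insert a ` Pow V) = p * subset_mean V p (\<lambda>R. f (insert a R))" .
  have "subset_mean (insert a V) p f = sum ?w (Pow V \<union> insert a ` Pow V)"
    by (simp add: subset_mean_def Pow_insert)
  also have "\<dots> = sum ?w (Pow V) + sum ?w (insert a ` Pow V)"
    using assms by (intro sum.union_disjoint) auto
  finally show ?thesis using 1 2 by simp
qed

lemma subset_mean_const: "finite V \<Longrightarrow> subset_mean V p (\<lambda>_. c) = c"
proof (induction V rule: finite_induct)
  case empty
  show ?case by (simp add: subset_mean_def)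
next
  case (insert a V)
  then show ?case by (simp add: subset_mean_insert algebra_simps)
qed

lemma subset_mean_bounds:
  assumes "finite V" "0 \<le> p" "p \<le> 1" "\<And>R. R \<subseteq> V \<Longrightarrow> 0 \<le> f R \<and> f R \<le> 1"
  shows "0 \<le> subset_mean V p f" "subset_mean V p f \<le> 1"
  using subset_mean_mono[of p V "\<lambda>_. 0" f] subset_mean_mono[of p V f "\<lambda>_. 1"] assms
  by (auto simp: subset_mean_const)

lemma subset_mean_abs_diff_le:
  assumes "0 \<le> p" "p \<le> 1" "\<And>R. R \<subseteq> V \<Longrightarrow> \<bar>f R - g R\<bar> \<le> e R"
  shows "\<bar>subset_mean V p f - subset_mean V p g\<bar> \<le> subset_mean V p e"
proof -
  have "subset_mean V p (\<lambda>R. f R - g R) \<le> subset_mean V p e"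
    "subset_mean V p (\<lambda>R. g R - f R) \<le> subset_mean V p e"
    using assms(3) by (intro subset_mean_mono[OF assms(1,2)]; fastforce simp: abs_le_iff)+
  then show ?thesis by (simp add: subset_mean_diff)
qed

text \<open>Given that \<open>a\<close> is chosen, the other points keep their law. The right-hand
  side may still average over all of \<open>V\<close>, since inserting \<open>a\<close> erases
  whether it was chosen before.\<close>

lemma subset_mean_member:
  assumes "finite V" "a \<in> V"
  shows "subset_mean V p (\<lambda>R. if a \<in> R then f R else 0) = p * subset_mean V p (\<lambda>R. f (insert a R))"
proof -
  obtain W where W: "V = insert a W" "a \<notin> W" "finite W"
    using assms by (metis Set.set_insert finite_insert)
  have "subset_mean W p (\<lambda>R. if a \<in> R then f R else 0) = subset_mean W p (\<lambda>_. 0)"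
    using W by (intro subset_mean_cong) auto
  then show ?thesis
    using W by (simp add: subset_mean_insert subset_mean_const algebra_simps)
qed

section \<open>Moments of the number of chosen points\<close>

text \<open>A discrete Mecke formula: summing over the chosen points of \<open>B\<close> amounts to
  planting each point of \<open>B\<close> in an unconditioned random set, with weight
  \<open>p\<close>.\<close>

lemma subset_mean_sum_Int:
  assumes "finite V" "B \<subseteq> V"
  shows "subset_mean V p (\<lambda>R. \<Sum>a\<in>R \<inter> B. f a R) =
    p * (\<Sum>a\<in>B. subset_mean V p (\<lambda>R. f a (insert a R)))"
proof -
  have B: "finite B" using assms finite_subset by auto
  have "(\<Sum>a\<in>R \<inter> B. f a R) = (\<Sum>a\<in>B. if a \<in> R then f a R else 0)" for R
    using B by (simp add: sum.inter_restrict Int_commute)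
  then have "subset_mean V p (\<lambda>R. \<Sum>a\<in>R \<inter> B. f a R) =
      (\<Sum>a\<in>B. subset_mean V p (\<lambda>R. if a \<in> R then f a R else 0))"
    by (simp add: subset_mean_sum)
  also have "\<dots> = (\<Sum>a\<in>B. p * subset_mean V p (\<lambda>R. f a (insert a R)))"
    using assms by (intro sum.cong subset_mean_member) auto
  finally show ?thesis by (simp add: sum_distrib_left)
qed

lemma subset_mean_card_Int:
  assumes "finite V" "B \<subseteq> V"
  shows "subset_mean V p (\<lambda>R. real (card (R \<inter> B))) = p * card B"
  using subset_mean_sum_Int[OF assms, of p "\<lambda>_ _. 1"] assms(1)
  by (simp add: subset_mean_const)

text \<open>The squared count is the sum of the count over the chosen points of \<open>B\<close>.
  Planting one of them raises the count by at most 1, so the second moment is at most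
  \<open>\<mu> + \<mu>\<^sup>2\<close>.\<close>

lemma subset_mean_variance:
  fixes p :: real
  assumes "finite V" "B \<subseteq> V" "0 \<le> p" "p \<le> 1"
  shows "subset_mean V p (\<lambda>R. (real (card (R \<inter> B)) - p * card B)\<^sup>2) \<le> p * card B"
proof -
  define \<mu> where "\<mu> = p * real (card B)"
  have B: "finite B" using assms finite_subset by auto
  have "subset_mean V p (\<lambda>R. (real (card (R \<inter> B)))\<^sup>2) =
      subset_mean V p (\<lambda>R. \<Sum>a\<in>R \<inter> B. real (card (R \<inter> B)))"
    by (simp add: power2_eq_square)
  also have "\<dots> = p * (\<Sum>a\<in>B. subset_mean V p (\<lambda>R. real (card (insert a R \<inter> B))))"
    by (rule subset_mean_sum_Int[OF assms(1,2)])
  also have "\<dots> \<le> p * (\<Sum>a\<in>B. 1 + \<mu>)"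
  proof (intro mult_left_mono sum_mono)
    fix a assume "a \<in> B"
    then have "card (insert a R \<inter> B) \<le> 1 + card (R \<inter> B)" for R
      using card_insert_le_m1[of "Suc (card (R \<inter> B))" "R \<inter> B" a] B
      by (simp add: card_insert_if)
    then have "real (card (insert a R \<inter> B)) \<le> 1 + real (card (R \<inter> B))" for R
      by (metis of_nat_1 of_nat_add of_nat_le_iff)
    then have "subset_mean V p (\<lambda>R. real (card (insert a R \<inter> B))) \<le>
        subset_mean V p (\<lambda>R. 1 + real (card (R \<inter> B)))"
      by (intro subset_mean_mono assms)
    also have "\<dots> = 1 + \<mu>"
      using assms by (simp add: subset_mean_add subset_mean_const subset_mean_card_Int \<mu>_def)
    finally show "subset_mean V p (\<lambda>R. real (card (insert a R \<inter> B))) \<le> 1 + \<mu>" .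
  qed (use assms in auto)
  also have "\<dots> = \<mu> + \<mu>\<^sup>2"
    by (simp add: \<mu>_def algebra_simps power2_eq_square)
  finally have sq: "subset_mean V p (\<lambda>R. (real (card (R \<inter> B)))\<^sup>2) \<le> \<mu> + \<mu>\<^sup>2" .
  have "(real (card (R \<inter> B)) - \<mu>)\<^sup>2 =
      (real (card (R \<inter> B)))\<^sup>2 - 2 * \<mu> * real (card (R \<inter> B)) + \<mu>\<^sup>2" for R
    by (simp add: power2_diff)
  then have "subset_mean V p (\<lambda>R. (real (card (R \<inter> B)) - \<mu>)\<^sup>2) =
      subset_mean V p (\<lambda>R. (real (card (R \<inter> B)))\<^sup>2) - 2 * \<mu> * \<mu> + \<mu>\<^sup>2"
    using assms by (simp add: subset_mean_add subset_mean_diff subset_mean_cmult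
        subset_mean_const subset_mean_card_Int \<mu>_def)
  then show ?thesis
    using sq unfolding \<mu>_def[symmetric] by (simp add: power2_eq_square)
qed

text \<open>Instead of Cauchy-Schwarz, AM-GM is applied pointwise with the standard deviation bound
  \<open>s = sqrt \<mu>\<close> as scale, and the result is averaged.\<close>

lemma subset_mean_abs_deviation:
  fixes p :: real
  assumes "finite V" "B \<subseteq> V" "0 \<le> p" "p \<le> 1" "p * card B > 0"
  shows "subset_mean V p (\<lambda>R. \<bar>real (card (R \<inter> B)) - p * card B\<bar>) \<le> sqrt (p * card B)"
proof -
  define \<mu> where "\<mu> = p * real (card B)"
  define s where "s = sqrt \<mu>"
  have s: "s > 0" "s\<^sup>2 = \<mu>" using assms by (auto simp: s_def \<mu>_def)
  have amgm: "\<bar>y\<bar> \<le> (s + y\<^sup>2 / s) / 2" for y :: real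
  proof -
    have "0 \<le> (s - \<bar>y\<bar>)\<^sup>2" by simp
    then have "2 * s * \<bar>y\<bar> \<le> s\<^sup>2 + y\<^sup>2" by (simp add: power2_diff)
    then show ?thesis using s(1) by (simp add: field_simps power2_eq_square)
  qed
  have "subset_mean V p (\<lambda>R. \<bar>real (card (R \<inter> B)) - \<mu>\<bar>) \<le>
      subset_mean V p (\<lambda>R. (s + (real (card (R \<inter> B)) - \<mu>)\<^sup>2 / s) / 2)"
    by (intro subset_mean_mono assms amgm)
  also have "\<dots> = (s + subset_mean V p (\<lambda>R. (real (card (R \<inter> B)) - \<mu>)\<^sup>2) / s) / 2"
    using assms by (simp only: subset_mean_divide subset_mean_add subset_mean_const)
  also have "\<dots> \<le> (s + \<mu> / s) / 2"
    using subset_mean_variance[OF assms(1-4)] s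
    by (simp add: \<mu>_def divide_right_mono)
  also have "\<dots> = s" using s by (simp add: field_simps power2_eq_square)
  finally show ?thesis by (simp add: \<mu>_def s_def)
qed

section \<open>Testers on uniform distributions\<close>

text \<open>The value at the empty set lives outside every \<open>{1..n}\<close>, so that all queries to it are
  answered uniformly.\<close>

definition uniform_on :: "nat set \<Rightarrow> nat pmf" where
  "uniform_on S = (if S = {} then return_pmf 0 else pmf_of_set S)"

definition accept_prob :: "nat set \<Rightarrow> tester \<Rightarrow> real" where
  "accept_prob S t = pmf (run (uniform_on S) t) True"

lemma accept_prob_bounds: "0 \<le> accept_prob S t" "accept_prob S t \<le> 1"
  by (simp_all add: accept_prob_def pmf_le_1)

lemma cond_dist_uniform_on:
  assumes "A \<subseteq> {1..n}" "A \<noteq> {}" "S \<subseteq> {1..n}"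
  shows "cond_dist (uniform_on S) A = pmf_of_set (if S \<inter> A = {} then A else S \<inter> A)"
proof -
  have fin: "finite A" "finite S" using assms finite_subset by auto
  show ?thesis
  proof (cases "S \<inter> A = {}")
    case True
    have "set_pmf (uniform_on S) \<inter> A = {}"
      using True fin assms(1) by (auto simp: uniform_on_def)
    then have "measure_pmf.prob (uniform_on S) A = 0"
      by (simp add: measure_pmf_zero_iff)
    then show ?thesis using True by (simp add: cond_dist_def)
  next
    case False
    then have ne: "S \<noteq> {}" by auto
    have prob: "measure_pmf.prob (uniform_on S) A = card (S \<inter> A) / card S"
      using ne fin by (simp add: uniform_on_def measure_pmf_of_set)
    have pos: "card (S \<inter> A) > 0" "card S > 0"
      using False ne fin by (auto simp: card_gt_0_iff)
    have "set_pmf (uniform_on S) \<inter> A \<noteq> {}"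
      using False ne fin by (simp add: uniform_on_def)
    then have "cond_pmf (uniform_on S) A = pmf_of_set (S \<inter> A)"
      using prob pos False ne fin
      by (intro pmf_eqI) (simp add: pmf_cond uniform_on_def indicator_def)
    then show ?thesis
      using False prob pos by (simp add: cond_dist_def)
  qed
qed

lemma accept_prob_Query:
  assumes "A \<subseteq> {1..n}" "A \<noteq> {}" "S \<subseteq> {1..n}"
  defines "B \<equiv> (if S \<inter> A = {} then A else S \<inter> A)"
  shows "accept_prob S (Query A k) = (\<Sum>a\<in>B. accept_prob S (k a)) / card B"
proof -
  have "finite B" "B \<noteq> {}"
    using assms finite_subset[of A "{1..n}"] by (auto simp: B_def)
  then show ?thesis
    using cond_dist_uniform_on[OF assms(1-3)]
    by (simp add: accept_prob_def pmf_bind integral_pmf_of_set B_def)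
qed

lemma accept_prob_Toss:
  "accept_prob S (Toss P) = (\<integral>t. accept_prob S t \<partial>measure_pmf P)"
  by (simp add: accept_prob_def pmf_join)

text \<open>The points of \<open>K\<close> are those already known to lie in the support.\<close>

definition random_accept :: "nat \<Rightarrow> real \<Rightarrow> nat set \<Rightarrow> tester \<Rightarrow> real" where
  "random_accept n p K t = subset_mean {1..n} p (\<lambda>R. accept_prob (K \<union> R) t)"

lemma random_accept_bounds:
  assumes "0 \<le> p" "p \<le> 1"
  shows "0 \<le> random_accept n p K t" "random_accept n p K t \<le> 1"
  unfolding random_accept_def using assms
  by (auto intro!: subset_mean_bounds simp: accept_prob_bounds)

lemma integrable_accept_prob: "integrable (measure_pmf P) (accept_prob S)"
  by (rule measure_pmf.integrable_const_bound[where B = 1])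
    (auto simp: accept_prob_bounds)

lemma random_accept_Toss:
  "random_accept n p K (Toss P) = (\<integral>t. random_accept n p K t \<partial>measure_pmf P)"
  unfolding random_accept_def subset_mean_def accept_prob_Toss
  by (subst Bochner_Integration.integral_sum) (auto intro: integrable_accept_prob)

section \<open>Effect of a single query\<close>

text \<open>If \<open>R\<close> misses \<open>A - K\<close>, the answer is uniform on
  \<open>B\<close>, whatever \<open>R\<close> is. Otherwise the error is at most 1, hence at most
  the number of hits, whose mean is \<open>p * card (A - K)\<close>.\<close>

lemma random_accept_Query_small:
  fixes p :: real
  assumes "A \<subseteq> {1..n}" "A \<noteq> {}" "K \<subseteq> {1..n}" "0 \<le> p" "p \<le> 1"
  defines "B \<equiv> (if K \<inter> A = {} then A else K \<inter> A)"
  shows "\<bar>random_accept n p K (Query A k) - (\<Sum>a\<in>B. random_accept n p K (k a)) / card B\<bar>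
    \<le> p * card (A - K)"
proof -
  have fin: "finite A" using assms finite_subset by auto
  then have B: "finite B" "B \<noteq> {}" using assms by (auto simp: B_def)
  have "\<bar>random_accept n p K (Query A k) -
      subset_mean {1..n} p (\<lambda>R. (\<Sum>a\<in>B. accept_prob (K \<union> R) (k a)) / card B)\<bar>
      \<le> subset_mean {1..n} p (\<lambda>R. real (card (R \<inter> (A - K))))"
    unfolding random_accept_def
  proof (intro subset_mean_abs_diff_le assms)
    fix R assume R: "R \<subseteq> {1..n}"
    show "\<bar>accept_prob (K \<union> R) (Query A k) - (\<Sum>a\<in>B. accept_prob (K \<union> R) (k a)) / card B\<bar>
        \<le> real (card (R \<inter> (A - K)))"
    proof (cases "R \<inter> (A - K) = {}")
      case True
      then have "(K \<union> R) \<inter> A = K \<inter> A" by auto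
      then show ?thesis
        using accept_prob_Query[OF assms(1,2), of "K \<union> R" k] R assms(3) by (simp add: B_def)
    next
      case False
      then have "1 \<le> card (R \<inter> (A - K))"
        using fin by (simp add: Suc_le_eq card_gt_0_iff)
      moreover have "(\<Sum>a\<in>B. accept_prob (K \<union> R) (k a)) \<le> card B"
        using sum_bounded_above[of B "\<lambda>a. accept_prob (K \<union> R) (k a)" 1]
        by (simp add: accept_prob_bounds)
      then have "(\<Sum>a\<in>B. accept_prob (K \<union> R) (k a)) / card B \<le> 1"
        using B by (simp add: divide_le_eq card_gt_0_iff)
      moreover have "0 \<le> (\<Sum>a\<in>B. accept_prob (K \<union> R) (k a)) / card B"
        by (simp add: sum_nonneg accept_prob_bounds)
      ultimately show ?thesis
        using accept_prob_bounds[of "K \<union> R" "Query A k"] by linarith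
    qed
  qed
  moreover have "A - K \<subseteq> {1..n}" using assms by auto
  ultimately show ?thesis
    by (simp add: subset_mean_divide subset_mean_sum subset_mean_card_Int random_accept_def)
qed

text \<open>Here \<open>z\<close> and \<open>c\<close> count the new and the known points of the
  support in the queried set, and \<open>u\<close> and \<open>v\<close> sum the acceptance
  probabilities over them. The \<open>u\<close> part only feels the change of denominator. The
  \<open>v\<close> part is at most \<open>2 * c / \<mu>\<close> if \<open>z \<ge> \<mu> / 2\<close>;
  otherwise \<open>\<bar>z - \<mu>\<bar>\<close> is so large that the trivial bound 1
  suffices.\<close>

lemma sample_average_deviation:
  fixes z c \<mu> u v :: real
  assumes "\<mu> > 0" "0 \<le> c" "0 \<le> u" "u \<le> z" "0 \<le> v" "v \<le> c" "z + c > 0"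
  shows "\<bar>(u + v) / (z + c) - u / \<mu>\<bar> \<le> 3 * (c + \<bar>z - \<mu>\<bar>) / \<mu>"
proof -
  have zc: "0 \<le> z" using assms by linarith
  have "u / (z + c) - u / \<mu> = u / (z + c) * ((\<mu> - z - c) / \<mu>)"
    using assms by (simp add: field_simps)
  then have "\<bar>u / (z + c) - u / \<mu>\<bar> = u / (z + c) * (\<bar>\<mu> - z - c\<bar> / \<mu>)"
    using assms by (simp add: abs_mult)
  also have "\<dots> \<le> 1 * ((c + \<bar>z - \<mu>\<bar>) / \<mu>)"
    using assms by (intro mult_mono divide_right_mono) (auto simp: divide_le_eq)
  finally have 1: "\<bar>u / (z + c) - u / \<mu>\<bar> \<le> (c + \<bar>z - \<mu>\<bar>) / \<mu>" by simp
  have 2: "v / (z + c) \<le> 2 * (c + \<bar>z - \<mu>\<bar>) / \<mu>"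
  proof (cases "z \<ge> \<mu> / 2")
    case True
    have "v / (z + c) \<le> c / (\<mu> / 2)"
      using True assms by (intro frac_le) auto
    also have "\<dots> \<le> 2 * (c + \<bar>z - \<mu>\<bar>) / \<mu>"
      using assms by (simp add: divide_right_mono)
    finally show ?thesis .
  next
    case False
    have "v / (z + c) \<le> 1" using assms zc by (simp add: divide_le_eq)
    also have "\<dots> \<le> 2 * (c + \<bar>z - \<mu>\<bar>) / \<mu>"
      using False assms by (simp add: le_divide_eq)
    finally show ?thesis .
  qed
  have 3: "0 \<le> v / (z + c)" using assms by simp
  have "(u + v) / (z + c) = u / (z + c) + v / (z + c)" by (rule add_divide_distrib)
  moreover have "3 * (c + \<bar>z - \<mu>\<bar>) / \<mu> = (c + \<bar>z - \<mu>\<bar>) / \<mu> + 2 * (c + \<bar>z - \<mu>\<bar>) / \<mu>"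
    by (simp add: add_divide_distrib[symmetric])
  ultimately show ?thesis using 1 2 3 by linarith
qed

text \<open>The error has two sources: answers among the at most \<open>card K\<close> known points,
  and the fluctuation, of order \<open>sqrt \<mu>\<close>, of the number of new points hit. Both are
  measured against the expected number \<open>\<mu>\<close> of new points.\<close>

lemma random_accept_Query_large:
  fixes p :: real
  assumes "A \<subseteq> {1..n}" "A \<noteq> {}" "K \<subseteq> {1..n}" "0 \<le> p" "p \<le> 1" "p * card (A - K) > 0"
  shows "\<bar>random_accept n p K (Query A k) -
      (\<Sum>a\<in>A - K. random_accept n p (insert a K) (k a)) / card (A - K)\<bar>
    \<le> 3 * (card K + sqrt (p * card (A - K))) / (p * card (A - K))"
proof -
  define B where "B = A - K"
  define \<mu> where "\<mu> = p * real (card B)"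
  define c where "c = real (card (K \<inter> A))"
  have fin: "finite A" "finite K" "finite B" using assms finite_subset by (auto simp: B_def)
  have BV: "B \<subseteq> {1..n}" using assms by (auto simp: B_def)
  have \<mu>: "\<mu> > 0" using assms by (simp add: \<mu>_def B_def)
  then have pB: "p > 0" "card B > 0" using assms(4) by (auto simp: \<mu>_def zero_less_mult_iff)
  have c: "0 \<le> c" "c \<le> card K" using fin by (auto simp: c_def card_mono)
  txt \<open>Reweighting the true joint law of the random set and the answer by
    \<open>card ((K \<union> R) \<inter> A) / \<mu>\<close>, which is concentrated around 1, makes the answer uniform on \<open>B\<close>.\<close>
  let ?H = "\<lambda>R. \<Sum>a\<in>R \<inter> B. accept_prob (K \<union> R) (k a)"
  have "subset_mean {1..n} p (\<lambda>R. ?H R / \<mu>) =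
      p * (\<Sum>a\<in>B. subset_mean {1..n} p (\<lambda>R. accept_prob (K \<union> insert a R) (k a))) / \<mu>"
    using subset_mean_sum_Int[OF _ BV, of p "\<lambda>a R. accept_prob (K \<union> R) (k a)"]
    by (simp add: subset_mean_divide)
  also have "\<dots> = (\<Sum>a\<in>B. random_accept n p (insert a K) (k a)) / card B"
    using pB by (simp add: \<mu>_def random_accept_def)
  finally have Y: "subset_mean {1..n} p (\<lambda>R. ?H R / \<mu>) =
      (\<Sum>a\<in>B. random_accept n p (insert a K) (k a)) / card B" .
  have "\<bar>random_accept n p K (Query A k) - subset_mean {1..n} p (\<lambda>R. ?H R / \<mu>)\<bar>
      \<le> subset_mean {1..n} p (\<lambda>R. 3 * (c + \<bar>real (card (R \<inter> B)) - \<mu>\<bar>) / \<mu>)"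
    unfolding random_accept_def
  proof (intro subset_mean_abs_diff_le assms)
    fix R assume R: "R \<subseteq> {1..n}"
    define z where "z = real (card (R \<inter> B))"
    define v where "v = (\<Sum>a\<in>K \<inter> A. accept_prob (K \<union> R) (k a))"
    have u: "0 \<le> ?H R" "?H R \<le> z"
      using sum_bounded_above[of "R \<inter> B" "\<lambda>a. accept_prob (K \<union> R) (k a)" 1]
      by (auto simp: z_def accept_prob_bounds sum_nonneg)
    have v: "0 \<le> v" "v \<le> c"
      using sum_bounded_above[of "K \<inter> A" "\<lambda>a. accept_prob (K \<union> R) (k a)" 1]
      by (auto simp: v_def c_def accept_prob_bounds sum_nonneg)
    have split: "(K \<union> R) \<inter> A = (R \<inter> B) \<union> (K \<inter> A)" "(R \<inter> B) \<inter> (K \<inter> A) = {}"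
      by (auto simp: B_def)
    have cards: "real (card ((K \<union> R) \<inter> A)) = z + c"
      using split fin by (simp add: card_Un_disjoint z_def c_def)
    show "\<bar>accept_prob (K \<union> R) (Query A k) - ?H R / \<mu>\<bar> \<le>
        3 * (c + \<bar>real (card (R \<inter> B)) - \<mu>\<bar>) / \<mu>"
    proof (cases "(K \<union> R) \<inter> A = {}")
      \<comment> \<open>No point of the support is queried: \<open>?H R\<close> is an empty sum and
        the right-hand side equals 3.\<close>
      case True
      then have "R \<inter> B = {}" "c = 0" using split c_def by auto
      moreover have "\<mu> \<le> 3 * \<bar>\<mu>\<bar>" using \<mu> by simp
      ultimately show ?thesis
        using \<mu> accept_prob_bounds[of "K \<union> R" "Query A k"] by simp
    next
      case False
      then have pos: "z + c > 0"
        unfolding cards[symmetric] using fin by (simp add: card_gt_0_iff)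
      have "(\<Sum>a\<in>(K \<union> R) \<inter> A. accept_prob (K \<union> R) (k a)) = ?H R + v"
        using split fin by (simp add: sum.union_disjoint v_def)
      then have "accept_prob (K \<union> R) (Query A k) = (?H R + v) / (z + c)"
        using accept_prob_Query[OF assms(1,2), of "K \<union> R" k] R assms(3) False cards by simp
      then show ?thesis
        using sample_average_deviation[OF \<mu> c(1) u v pos] by (simp add: z_def)
    qed
  qed
  also have "\<dots> = 3 * (c + subset_mean {1..n} p (\<lambda>R. \<bar>real (card (R \<inter> B)) - \<mu>\<bar>)) / \<mu>"
    by (simp only: subset_mean_divide subset_mean_cmult subset_mean_add subset_mean_const
        finite_atLeastAtMost)
  also have "\<dots> \<le> 3 * (card K + sqrt \<mu>) / \<mu>"
    using subset_mean_abs_deviation[OF _ BV assms(4,5)] \<mu> c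
    by (intro divide_right_mono mult_left_mono add_mono) (auto simp: \<mu>_def)
  finally show ?thesis unfolding Y by (simp only: \<mu>_def B_def)
qed

section \<open>Variation across the scales\<close>

text \<open>A step from \<open>i\<close> to \<open>Suc i\<close> that avoids \<open>\<theta>\<close>
  stays within one regime and costs an extra \<open>2 * e\<close>. At most two steps touch
  \<open>\<theta>\<close>, and each of them changes \<open>f\<close> by at most 1.\<close>

lemma variation_two_regimes:
  fixes f x y :: "nat \<Rightarrow> real"
  assumes "\<And>i. i \<le> m \<Longrightarrow> 0 \<le> f i \<and> f i \<le> 1"
    and "\<And>i. i \<le> m \<Longrightarrow> i < \<theta> \<Longrightarrow> \<bar>f i - x i\<bar> \<le> e"
    and "\<And>i. i \<le> m \<Longrightarrow> \<theta> < i \<Longrightarrow> \<bar>f i - y i\<bar> \<le> e"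
    and "0 \<le> e"
  shows "(\<Sum>i<m. \<bar>f i - f (Suc i)\<bar>) \<le>
    (\<Sum>i<m. \<bar>x i - x (Suc i)\<bar>) + (\<Sum>i<m. \<bar>y i - y (Suc i)\<bar>) + 2 + 2 * e * m"
proof -
  have "\<bar>f i - f (Suc i)\<bar> \<le> \<bar>x i - x (Suc i)\<bar> + \<bar>y i - y (Suc i)\<bar> + 2 * e +
      ((if i = \<theta> then 1 else 0) + (if i = \<theta> - 1 then 1 else 0))" if "i < m" for i
  proof -
    let ?b = "(if i = \<theta> then 1 else 0) + (if i = \<theta> - 1 then 1 else 0) :: real"
    have b: "0 \<le> ?b" by simp
    consider "Suc i < \<theta>" | "\<theta> < i" | "i = \<theta> \<or> i = \<theta> - 1" by linarith
    then show ?thesis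
    proof cases
      case 1
      then have "\<bar>f i - x i\<bar> \<le> e" "\<bar>f (Suc i) - x (Suc i)\<bar> \<le> e"
        using assms(2)[of i] assms(2)[of "Suc i"] that by auto
      then show ?thesis using b by linarith
    next
      case 2
      then have "\<bar>f i - y i\<bar> \<le> e" "\<bar>f (Suc i) - y (Suc i)\<bar> \<le> e"
        using assms(3)[of i] assms(3)[of "Suc i"] that by auto
      then show ?thesis using b by linarith
    next
      case 3
      then have "1 \<le> ?b" by auto
      moreover have "0 \<le> f i" "f i \<le> 1" "0 \<le> f (Suc i)" "f (Suc i) \<le> 1"
        using assms(1)[of i] assms(1)[of "Suc i"] that by auto
      ultimately show ?thesis using assms(4) by linarith
    qed
  qed
  then have "(\<Sum>i<m. \<bar>f i - f (Suc i)\<bar>) \<le> (\<Sum>i<m. \<bar>x i - x (Suc i)\<bar> + \<bar>y i - y (Suc i)\<bar> + 2 * e +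
      ((if i = \<theta> then 1 else 0) + (if i = \<theta> - 1 then 1 else 0)))"
    by (intro sum_mono) auto
  also have "\<dots> = (\<Sum>i<m. \<bar>x i - x (Suc i)\<bar>) + (\<Sum>i<m. \<bar>y i - y (Suc i)\<bar>) + 2 * e * m +
      ((\<Sum>i<m. if i = \<theta> then 1 else 0) + (\<Sum>i<m. if i = \<theta> - 1 then 1 else 0))"
    by (simp add: sum.distrib)
  also have "\<dots> \<le> (\<Sum>i<m. \<bar>x i - x (Suc i)\<bar>) + (\<Sum>i<m. \<bar>y i - y (Suc i)\<bar>) + 2 * e * m + (1 + 1)"
    by (intro add_mono) auto
  finally show ?thesis by simp
qed

text \<open>Variation is convex, by the triangle inequality. The assumption \<open>0 \<le> C\<close>
  covers an empty \<open>B\<close>, where the quotients are 0; this happens when all of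
  \<open>A\<close> is known.\<close>

lemma variation_average:
  fixes F :: "'a \<Rightarrow> nat \<Rightarrow> real"
  assumes "finite B" "0 \<le> C" "\<And>a. a \<in> B \<Longrightarrow> (\<Sum>i<m. \<bar>F a i - F a (Suc i)\<bar>) \<le> C"
  shows "(\<Sum>i<m. \<bar>(\<Sum>a\<in>B. F a i) / card B - (\<Sum>a\<in>B. F a (Suc i)) / card B\<bar>) \<le> C"
proof (cases "B = {}")
  case False
  then have pos: "card B > 0" using assms by (simp add: card_gt_0_iff)
  have "(\<Sum>i<m. \<bar>(\<Sum>a\<in>B. F a i) / card B - (\<Sum>a\<in>B. F a (Suc i)) / card B\<bar>)
      = (\<Sum>i<m. \<bar>\<Sum>a\<in>B. F a i - F a (Suc i)\<bar>) / card B"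
    unfolding sum_divide_distrib[of _ "{..<m}"]
    by (simp add: sum_subtractf diff_divide_distrib[symmetric])
  also have "\<dots> \<le> (\<Sum>i<m. \<Sum>a\<in>B. \<bar>F a i - F a (Suc i)\<bar>) / card B"
    by (intro divide_right_mono sum_mono sum_abs) auto
  also have "\<dots> = (\<Sum>a\<in>B. \<Sum>i<m. \<bar>F a i - F a (Suc i)\<bar>) / card B"
    by (subst sum.swap) simp
  also have "\<dots> \<le> (\<Sum>a\<in>B. C) / card B"
    using assms by (intro divide_right_mono sum_mono) auto
  also have "\<dots> = C" using pos by simp
  finally show ?thesis .
qed (use assms in simp)

text \<open>\<open>\<theta>\<close> is the first scale at which the expected number of hits exceeds
  \<open>1 / h\<close>; the ratio \<open>h ^ 3\<close> lifts every later scale above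
  \<open>h\<^sup>2\<close>. If there is no such scale up to \<open>m\<close>, \<open>Suc m\<close>
  serves.\<close>

lemma geometric_threshold:
  fixes p :: "nat \<Rightarrow> real"
  assumes "\<And>i j. i < j \<Longrightarrow> j \<le> m \<Longrightarrow> p i * h ^ 3 \<le> p j" "0 \<le> N" "1 \<le> h"
  shows "\<exists>\<theta>. \<forall>i\<le>m. (i < \<theta> \<longrightarrow> p i * N \<le> 1 / h) \<and> (\<theta> < i \<longrightarrow> h\<^sup>2 \<le> p i * N)"
proof (cases "\<exists>i\<le>m. 1 / h < p i * N")
  case True
  define \<theta> where "\<theta> = (LEAST i. 1 / h < p i * N)"
  have \<theta>: "1 / h < p \<theta> * N"
    unfolding \<theta>_def by (rule LeastI_ex) (use True in blast)
  show ?thesis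
  proof (intro exI[of _ \<theta>] allI impI conjI)
    fix i assume "i < \<theta>"
    then show "p i * N \<le> 1 / h"
      unfolding \<theta>_def using not_less_Least linorder_not_less by blast
  next
    fix i assume i: "i \<le> m" "\<theta> < i"
    have "h\<^sup>2 = 1 / h * h ^ 3"
      using assms(3) by (simp add: power2_eq_square power3_eq_cube)
    also have "\<dots> \<le> p \<theta> * N * h ^ 3"
      using \<theta> assms(3) by (intro mult_right_mono) auto
    also have "\<dots> = p \<theta> * h ^ 3 * N" by simp
    also have "\<dots> \<le> p i * N"
      using assms i by (intro mult_right_mono) auto
    finally show "h\<^sup>2 \<le> p i * N" .
  qed
next
  case False
  then show ?thesis by (intro exI[of _ "Suc m"]) (auto simp: not_less)
qed

text \<open>The bound solves the recursion \<open>C' = 2 * C + 3\<close>: two continuations, 2 for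
  the steps at the threshold and 1 for all approximation errors together. The budget
  \<open>card K + q\<close> never grows, because a query adds at most one point to
  \<open>K\<close>.\<close>

lemma random_accept_variation:
  fixes p :: "nat \<Rightarrow> real" and h :: real
  assumes "queries_le n q t"
    and p: "\<And>i. i \<le> m \<Longrightarrow> 0 \<le> p i \<and> p i \<le> 1"
    and gap: "\<And>i j. i < j \<Longrightarrow> j \<le> m \<Longrightarrow> p i * h ^ 3 \<le> p j"
    and h: "1 \<le> h" "12 * m \<le> h"
    and "K \<subseteq> {1..n}" "real (card K + q) \<le> h"
  shows "(\<Sum>i<m. \<bar>random_accept n (p i) K t - random_accept n (p (Suc i)) K t\<bar>) \<le> 3 * (2 ^ q - 1)"
  using assms(1,6,7)
proof (induction arbitrary: K rule: queries_le.induct)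
  case (1 q b)
  have "random_accept n r K (Decide b) = (if b then 1 else 0)" for r
    by (simp add: random_accept_def accept_prob_def subset_mean_const)
  then show ?case by simp
next
  case (2 A q k)
  define C :: real where "C = 3 * (2 ^ q - 1)"
  define B where "B = (if K \<inter> A = {} then A else K \<inter> A)"
  define N where "N = real (card (A - K))"
  have A: "A \<subseteq> {1..n}" "A \<noteq> {}" by (rule 2)+
  have K: "K \<subseteq> {1..n}" "real (card K + Suc q) \<le> h" by (rule 2)+
  have IH: "(\<Sum>i<m. \<bar>random_accept n (p i) L (k a) - random_accept n (p (Suc i)) L (k a)\<bar>) \<le> C"
    if "a \<in> A" "L \<subseteq> {1..n}" "real (card L + q) \<le> h" for a L
    using 2(3) that unfolding C_def by blast
  have fin: "finite A" "finite K" "finite B"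
    using A K finite_subset[of _ "{1..n}"] by (auto simp: B_def)
  have C: "0 \<le> C" by (simp add: C_def)
  have N: "0 \<le> N" by (simp add: N_def)
  have "\<exists>\<theta>. \<forall>i\<le>m. (i < \<theta> \<longrightarrow> p i * N \<le> 1 / h) \<and> (\<theta> < i \<longrightarrow> h\<^sup>2 \<le> p i * N)"
    by (rule geometric_threshold) (fact gap N h(1))+
  then obtain \<theta> where \<theta>:
    "\<forall>i\<le>m. (i < \<theta> \<longrightarrow> p i * N \<le> 1 / h) \<and> (\<theta> < i \<longrightarrow> h\<^sup>2 \<le> p i * N)" ..
  let ?f = "\<lambda>i. random_accept n (p i) K (Query A k)"
  let ?x = "\<lambda>i. (\<Sum>a\<in>B. random_accept n (p i) K (k a)) / card B"
  let ?y = "\<lambda>i. (\<Sum>a\<in>A - K. random_accept n (p i) (insert a K) (k a)) / card (A - K)"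
  have "(\<Sum>i<m. \<bar>?f i - ?f (Suc i)\<bar>) \<le>
      (\<Sum>i<m. \<bar>?x i - ?x (Suc i)\<bar>) + (\<Sum>i<m. \<bar>?y i - ?y (Suc i)\<bar>) + 2 + 2 * (6 / h) * m"
  proof (rule variation_two_regimes[where \<theta> = \<theta> and f = ?f and x = ?x and y = ?y])
    fix i assume i: "i \<le> m"
    then show "0 \<le> ?f i \<and> ?f i \<le> 1" using p[OF i] random_accept_bounds[of "p i"] by simp
  next
    fix i assume i: "i \<le> m" "i < \<theta>"
    have "\<bar>?f i - ?x i\<bar> \<le> p i * N"
      unfolding B_def N_def using p[OF i(1)] by (intro random_accept_Query_small A K) auto
    also have "\<dots> \<le> 1 / h" using \<theta> i by blast
    also have "\<dots> \<le> 6 / h" using h(1) by (intro divide_right_mono) auto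
    finally show "\<bar>?f i - ?x i\<bar> \<le> 6 / h" .
  next
    \<comment> \<open>With \<open>card K \<le> h\<close> and \<open>h\<^sup>2 \<le> \<mu>\<close>,
      known points and fluctuation contribute at most \<open>3 / h\<close> each. This is the source
      of the common error \<open>6 / h\<close>.\<close>
    fix i assume i: "i \<le> m" "\<theta> < i"
    define \<mu> where "\<mu> = p i * N"
    have \<mu>: "h\<^sup>2 \<le> \<mu>" using \<theta> i by (simp add: \<mu>_def)
    have "0 < h\<^sup>2" using h(1) by simp
    then have pos: "0 < \<mu>" using \<mu> by linarith
    have "h \<le> sqrt \<mu>" using \<mu> h(1) by (simp add: real_le_rsqrt)
    then have "1 / sqrt \<mu> \<le> 1 / h" using h(1) by (intro frac_le) auto
    moreover have "card K / \<mu> \<le> h / h\<^sup>2"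
      using K \<mu> h(1) \<open>0 < h\<^sup>2\<close> by (intro frac_le) auto
    moreover have "h / h\<^sup>2 = 1 / h" using h(1) by (simp add: power2_eq_square)
    moreover have "3 * (card K + sqrt \<mu>) / \<mu> = 3 * (card K / \<mu>) + 3 * (1 / sqrt \<mu>)"
      using pos by (simp add: field_simps)
    moreover have "\<bar>?f i - ?y i\<bar> \<le> 3 * (card K + sqrt \<mu>) / \<mu>"
      using p[OF i(1)] pos unfolding \<mu>_def N_def
      by (intro random_accept_Query_large A K) auto
    ultimately show "\<bar>?f i - ?y i\<bar> \<le> 6 / h" by simp
  qed (use h in simp)
  moreover have "(\<Sum>i<m. \<bar>?x i - ?x (Suc i)\<bar>) \<le> C"
    using fin C K
    by (intro variation_average[where F = "\<lambda>a i. random_accept n (p i) K (k a)"] IH)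
      (auto simp: B_def split: if_splits)
  moreover have "(\<Sum>i<m. \<bar>?y i - ?y (Suc i)\<bar>) \<le> C"
  proof (intro variation_average[where F = "\<lambda>a i. random_accept n (p i) (insert a K) (k a)"] C)
    fix a assume a: "a \<in> A - K"
    then have "card (insert a K) + q = card K + Suc q" using fin by simp
    then show "(\<Sum>i<m. \<bar>random_accept n (p i) (insert a K) (k a) -
        random_accept n (p (Suc i)) (insert a K) (k a)\<bar>) \<le> C"
      using A K a by (intro IH) auto
  qed (use fin in auto)
  \<comment> \<open>The assumption \<open>12 * m \<le> h\<close> keeps the errors accumulated over
    all \<open>m\<close> steps below 1.\<close>
  moreover have "2 * (6 / h) * m \<le> 1" using h by (simp add: field_simps)
  ultimately show ?case by (simp add: C_def)
next
  case (3 P q)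
  let ?F = "\<lambda>t i. random_accept n (p i) K t"
  have int: "integrable (measure_pmf P) (\<lambda>t. ?F t i)" if "i \<le> m" for i
    using random_accept_bounds p[OF that]
    by (intro measure_pmf.integrable_const_bound[where B = 1]) auto
  \<comment> \<open>Coin tosses average the acceptance probabilities, so convexity of the variation
    applies again, now with integrals.\<close>
  have "(\<Sum>i<m. \<bar>?F (Toss P) i - ?F (Toss P) (Suc i)\<bar>) \<le>
      (\<Sum>i<m. \<integral>t. \<bar>?F t i - ?F t (Suc i)\<bar> \<partial>measure_pmf P)"
  proof (rule sum_mono)
    fix i assume "i \<in> {..<m}"
    then have "?F (Toss P) i - ?F (Toss P) (Suc i) = (\<integral>t. ?F t i - ?F t (Suc i) \<partial>measure_pmf P)"
      using int by (simp add: random_accept_Toss)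
    then show "\<bar>?F (Toss P) i - ?F (Toss P) (Suc i)\<bar> \<le>
        (\<integral>t. \<bar>?F t i - ?F t (Suc i)\<bar> \<partial>measure_pmf P)"
      using integral_abs_bound by simp
  qed
  also have "\<dots> = (\<integral>t. (\<Sum>i<m. \<bar>?F t i - ?F t (Suc i)\<bar>) \<partial>measure_pmf P)"
    using int by (intro Bochner_Integration.integral_sum[symmetric]) auto
  also have "\<dots> \<le> 3 * (2 ^ q - 1)"
    using int 3 by (intro measure_pmf.integral_le_const Bochner_Integration.integrable_sum)
      (auto intro!: AE_pmfI)
  finally show ?case .
qed

section \<open>Acceptance probability at a single scale\<close>

text \<open>Chebyshev's inequality in averaged form: outside the window from
  \<open>\<mu> / 2\<close> to \<open>2 * \<mu>\<close>, the term \<open>4 / \<mu>\<^sup>2\<close>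
  times the squared deviation is at least 1, and its mean is at most
  \<open>4 / \<mu>\<close>.\<close>

lemma random_accept_near:
  fixes p b :: real
  assumes "0 \<le> p" "p \<le> 1" "0 \<le> b" "b \<le> 1" "\<mu> > 0" "\<mu> = p * n"
    and near: "\<And>R. R \<subseteq> {1..n} \<Longrightarrow> \<mu> \<le> 2 * real (card R) \<Longrightarrow>
      real (card R) \<le> 2 * \<mu> \<Longrightarrow> \<bar>accept_prob R t - b\<bar> \<le> 1/3"
  shows "\<bar>random_accept n p {} t - b\<bar> \<le> 1/3 + 4 / \<mu>"
proof -
  let ?e = "\<lambda>R. 1/3 + 4 / \<mu>\<^sup>2 * (real (card (R \<inter> {1..n})) - p * card {1..n})\<^sup>2"
  have "\<bar>random_accept n p {} t - subset_mean {1..n} p (\<lambda>_. b)\<bar> \<le> subset_mean {1..n} p ?e"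
    unfolding random_accept_def
  proof (intro subset_mean_abs_diff_le assms)
    fix R assume R: "R \<subseteq> {1..n}"
    define y where "y = real (card R) - \<mu>"
    have e: "?e R = 1/3 + 4 / \<mu>\<^sup>2 * y\<^sup>2"
      using R assms(6) by (simp add: y_def Int_absorb2)
    have "\<bar>accept_prob R t - b\<bar> \<le> 1/3 + 4 / \<mu>\<^sup>2 * y\<^sup>2"
    proof (cases "\<mu> \<le> 2 * real (card R) \<and> real (card R) \<le> 2 * \<mu>")
      case True
      moreover have "0 \<le> 4 / \<mu>\<^sup>2 * y\<^sup>2" by simp
      ultimately show ?thesis using near[OF R] by linarith
    next
      case False
      then have "\<mu> / 2 \<le> \<bar>y\<bar>" using assms(5) by (auto simp: y_def)
      then have "(\<mu> / 2)\<^sup>2 \<le> y\<^sup>2" using assms(5) by (simp add: abs_le_square_iff[symmetric])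
      then have "1 \<le> 4 / \<mu>\<^sup>2 * y\<^sup>2" using assms(5) by (simp add: field_simps power2_eq_square)
      then show ?thesis using accept_prob_bounds[of R t] assms(3,4) by linarith
    qed
    then show "\<bar>accept_prob ({} \<union> R) t - b\<bar> \<le> ?e R" unfolding e by simp
  qed
  also have "\<dots> = 1/3 + 4 / \<mu>\<^sup>2 *
      subset_mean {1..n} p (\<lambda>R. (real (card (R \<inter> {1..n})) - p * card {1..n})\<^sup>2)"
    by (simp only: subset_mean_add subset_mean_cmult subset_mean_const finite_atLeastAtMost)
  also have "\<dots> \<le> 1/3 + 4 / \<mu>\<^sup>2 * \<mu>"
    using subset_mean_variance[of "{1..n}" "{1..n}" p] assms(1,2,6)
    by (intro add_left_mono mult_left_mono) auto
  also have "\<dots> = 1/3 + 4 / \<mu>" by (simp add: power2_eq_square)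
  finally show ?thesis by (simp add: subset_mean_const)
qed

section \<open>The property\<close>

definition size_near :: "nat \<Rightarrow> nat set \<Rightarrow> bool" where
  "size_near s S \<longleftrightarrow> s \<le> 2 * card S \<and> card S \<le> 2 * s"

definition even_scale_uniform :: "nat \<Rightarrow> nat \<Rightarrow> nat pmf set" where
  "even_scale_uniform g n =
    {pmf_of_set S | S. S \<subseteq> {1..n} \<and> S \<noteq> {} \<and> (\<exists>i. even i \<and> size_near (g ^ Suc i) S)}"

text \<open>Relabeling carries the uniform distribution on \<open>S\<close> to the one on an image
  of the same size. The ratio \<open>g\<close> may depend on \<open>n\<close>, as the final choice
  requires.\<close>

lemma label_invariant_even_scale_uniform: "label_invariant (\<lambda>n. even_scale_uniform (g n) n)"
  unfolding label_invariant_def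
proof (intro allI conjI ballI impI)
  show "even_scale_uniform (g n) n \<subseteq> dists n" for n
  proof
    fix D assume "D \<in> even_scale_uniform (g n) n"
    then obtain S where "D = pmf_of_set S" "S \<subseteq> {1..n}" "S \<noteq> {}"
      by (auto simp: even_scale_uniform_def)
    then show "D \<in> dists n" using finite_subset[of S "{1..n}"] by (simp add: dists_def)
  qed
next
  fix n D \<pi>
  assume D: "D \<in> even_scale_uniform (g n) n" and \<pi>: "\<pi> permutes {1..n}"
  obtain S where S: "D = pmf_of_set S" "S \<subseteq> {1..n}" "S \<noteq> {}"
    "\<exists>i. even i \<and> size_near (g n ^ Suc i) S"
    using D by (auto simp: even_scale_uniform_def)
  have inv: "inv \<pi> permutes {1..n}" using \<pi> by (rule permutes_inv)
  then have inj: "inj_on (inv \<pi>) S" using permutes_inj_on by blast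
  have "inv \<pi> ` S \<subseteq> {1..n}"
    using S(2) permutes_image[OF inv] by blast
  moreover have "card (inv \<pi> ` S) = card S" using inj by (rule card_image)
  ultimately show "map_pmf (inv \<pi>) D \<in> even_scale_uniform (g n) n"
    using S inj finite_subset[OF S(2)]
    unfolding even_scale_uniform_def size_near_def
    by (intro CollectI exI[of _ "inv \<pi> ` S"]) (auto simp: map_pmf_of_set_inj)
qed

section \<open>Distance between scales of different parity\<close>

lemma d_TV_commute: "d_TV n D E = d_TV n E D"
  by (simp add: d_TV_def abs_minus_commute)

text \<open>On \<open>S\<close> the second distribution has at most half the density of the first,
  so the points of \<open>S\<close> alone contribute \<open>1/2\<close> to the sum of
  differences.\<close>

lemma d_TV_uniform_ge:
  assumes "S \<subseteq> {1..n}" "T \<subseteq> {1..n}" "S \<noteq> {}" "2 * card S \<le> card T"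
  shows "d_TV n (pmf_of_set S) (pmf_of_set T) \<ge> 1/4"
proof -
  have fin: "finite S" "finite T" using assms finite_subset by auto
  have pos: "0 < card S" "0 < card T" "T \<noteq> {}" using assms fin by (auto simp: card_gt_0_iff)
  have half: "1 / real (card T) \<le> 1 / (2 * real (card S))"
    using assms(4) pos by (intro divide_left_mono) auto
  have "1/2 = (\<Sum>s\<in>S. 1 / (2 * real (card S)))" using pos by simp
  also have "\<dots> \<le> (\<Sum>s\<in>S. \<bar>pmf (pmf_of_set S) s - pmf (pmf_of_set T) s\<bar>)"
  proof (rule sum_mono)
    fix s assume "s \<in> S"
    then have "pmf (pmf_of_set S) s = 1 / card S" "pmf (pmf_of_set T) s \<le> 1 / card T"
      using fin assms pos by (auto simp: indicator_def)
    moreover have "1 / real (card S) = 1 / (2 * real (card S)) + 1 / (2 * real (card S))"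
      by simp
    ultimately show "1 / (2 * real (card S)) \<le> \<bar>pmf (pmf_of_set S) s - pmf (pmf_of_set T) s\<bar>"
      using half by linarith
  qed
  also have "\<dots> \<le> (\<Sum>s\<in>{1..n}. \<bar>pmf (pmf_of_set S) s - pmf (pmf_of_set T) s\<bar>)"
    using assms by (intro sum_mono2) auto
  finally show ?thesis by (simp add: d_TV_def)
qed

text \<open>The factor 8 pays for both size windows, 2 each, and for the required ratio 2.\<close>

lemma size_near_gap:
  assumes "i < j" "8 \<le> g" "size_near (g ^ Suc i) S" "size_near (g ^ Suc j) T"
  shows "2 * card S \<le> card T"
proof -
  have "8 * g ^ Suc i \<le> g * g ^ Suc i" using assms(2) by (rule mult_right_mono) simp
  also have "\<dots> = g ^ Suc (Suc i)" by simp
  also have "\<dots> \<le> g ^ Suc j" using assms(1,2) by (intro power_increasing) auto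
  finally show ?thesis using assms(3,4) unfolding size_near_def by linarith
qed

lemma far_from_even_scale_uniform:
  assumes "S \<subseteq> {1..n}" "S \<noteq> {}" "odd i" "size_near (g ^ Suc i) S" "8 \<le> g"
  shows "far_from n (1/4) (pmf_of_set S) (even_scale_uniform g n)"
  unfolding far_from_def even_scale_uniform_def
proof clarify
  fix T j
  assume T: "T \<subseteq> {1..n}" "T \<noteq> {}" "even j" "size_near (g ^ Suc j) T"
  have "i \<noteq> j" using assms(3) T(3) by auto
  then consider "i < j" | "j < i" by linarith
  then show "1/4 \<le> d_TV n (pmf_of_set S) (pmf_of_set T)"
  proof cases
    case 1
    then show ?thesis using assms T size_near_gap by (intro d_TV_uniform_ge) auto
  next
    case 2
    then show ?thesis using assms T size_near_gap
      by (subst d_TV_commute) (intro d_TV_uniform_ge, auto)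
  qed
qed

text \<open>The tester errs with probability at most \<open>1/3\<close> on supports of typical size,
  and atypical sizes add at most \<open>4 / 48 = 1/12\<close>. The total \<open>5/12\<close> stays
  below \<open>1/2\<close>, which separates even from odd scales.\<close>

lemma random_accept_tester:
  assumes test: "tests_property n (even_scale_uniform g n) (1/4) t"
    and g: "48 \<le> g" "g ^ Suc i \<le> n"
  shows "\<bar>random_accept n (real (g ^ Suc i) / n) {} t - (if even i then 1 else 0)\<bar> \<le> 5/12"
proof -
  define s where "s = g ^ Suc i"
  have "g ^ 1 \<le> s" unfolding s_def using g by (intro power_increasing) auto
  then have s: "48 \<le> s" "s \<le> n" using g by (simp, simp add: s_def)
  have "\<bar>random_accept n (s / n) {} t - (if even i then 1 else 0)\<bar> \<le> 1/3 + 4 / real s"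
  proof (rule random_accept_near)
    fix R assume R: "R \<subseteq> {1..n}" "real s \<le> 2 * real (card R)" "real (card R) \<le> 2 * real s"
    then have near: "size_near s R" by (simp add: size_near_def)
    then have ne: "R \<noteq> {}" using s by (auto simp: size_near_def)
    have D: "pmf_of_set R \<in> dists n"
      using R ne finite_subset[of R "{1..n}"] by (simp add: dists_def)
    show "\<bar>accept_prob R t - (if even i then 1 else 0)\<bar> \<le> 1/3"
    proof (cases "even i")
      case True
      then have "pmf_of_set R \<in> even_scale_uniform g n"
        using R ne near by (auto simp: even_scale_uniform_def s_def)
      then have "2/3 \<le> accept_prob R t"
        using test D ne by (auto simp: tests_property_def accept_prob_def uniform_on_def)
      then show ?thesis using True accept_prob_bounds[of R t] by simp
    next
      case False
      then have "far_from n (1/4) (pmf_of_set R) (even_scale_uniform g n)"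
        using R ne near g by (intro far_from_even_scale_uniform) (auto simp: s_def)
      then have "2/3 \<le> pmf (run (pmf_of_set R) t) False"
        using test D by (auto simp: tests_property_def)
      then have "accept_prob R t \<le> 1/3"
        using ne by (simp add: accept_prob_def uniform_on_def pmf_False_conv_True)
      then show ?thesis using False accept_prob_bounds[of R t] by simp
    qed
  qed (use s in auto)
  moreover have "4 / real s \<le> 4 / 48" using s by (intro divide_left_mono) auto
  ultimately show ?thesis unfolding s_def by linarith
qed

section \<open>From jumps between scales to the query bound\<close>

text \<open>Each of the \<open>m\<close> steps contributes at least \<open>1/6\<close> to a
  variation of at most \<open>3 * 2 ^ q\<close>. The variation bound needs \<open>q \<le> h\<close>;
  for larger \<open>q\<close> the claim is immediate, as \<open>m < h < q < 2 ^ q\<close>.\<close>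

lemma query_lower_bound:
  fixes m n q :: nat
  defines "h \<equiv> 12 * Suc m"
  assumes "queries_le n q t" "tests_property n (even_scale_uniform (h ^ 3) n) (1/4) t"
    and n: "(h ^ 3) ^ Suc m \<le> n"
  shows "m \<le> 18 * 2 ^ q"
proof (cases "q \<le> h")
  case True
  define p where "p i = real ((h ^ 3) ^ Suc i) / real n" for i
  have h3: "48 \<le> h ^ 3"
    using power_mono[of 12 h 3] by (simp add: h_def)
  have n0: "0 < n" using n zero_less_power[of "h ^ 3" "Suc m"] h3 by linarith
  have le: "(h ^ 3) ^ Suc i \<le> n" if "i \<le> m" for i
    using power_increasing[of "Suc i" "Suc m" "h ^ 3"] that n h3 by linarith
  \<comment> \<open>The ideal values alternate between 1 and 0, so consecutive scales differ by at
    least \<open>1 - 2 * (5/12) = 1/6\<close>.\<close>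
  have "(\<Sum>i<m. 1/6) \<le> (\<Sum>i<m. \<bar>random_accept n (p i) {} t - random_accept n (p (Suc i)) {} t\<bar>)"
  proof (rule sum_mono)
    fix i assume "i \<in> {..<m}"
    then have i: "i \<le> m" "Suc i \<le> m" by auto
    have "\<bar>random_accept n (p i) {} t - (if even i then 1 else 0)\<bar> \<le> 5/12"
      "\<bar>random_accept n (p (Suc i)) {} t - (if even (Suc i) then 1 else 0)\<bar> \<le> 5/12"
      unfolding p_def by (intro random_accept_tester[OF assms(3) h3] le i)+
    then show "1/6 \<le> \<bar>random_accept n (p i) {} t - random_accept n (p (Suc i)) {} t\<bar>"
      by (cases "even i"; simp only: even_Suc if_True if_False simp_thms; linarith)
  qed
  also have "\<dots> \<le> 3 * (2 ^ q - 1)"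
  proof (rule random_accept_variation[OF assms(2), where h = h])
    show "0 \<le> p i \<and> p i \<le> 1" if "i \<le> m" for i
      unfolding p_def using le[OF that] n0
      by (simp only: of_nat_le_iff divide_le_eq_1_pos of_nat_0_less_iff) simp
    show "p i * real h ^ 3 \<le> p j" if "i < j" "j \<le> m" for i j
    proof -
      have "(h ^ 3) ^ Suc i * h ^ 3 = (h ^ 3) ^ Suc (Suc i)" by simp
      also have "\<dots> \<le> (h ^ 3) ^ Suc j" using that h3 by (intro power_increasing) auto
      finally have "real ((h ^ 3) ^ Suc i * h ^ 3) \<le> real ((h ^ 3) ^ Suc j)"
        by (simp only: of_nat_le_iff)
      then show ?thesis unfolding p_def by (simp add: divide_right_mono)
    qed
  qed (use True in \<open>auto simp: h_def\<close>)
  finally have "real m \<le> 18 * 2 ^ q" by simp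
  then show ?thesis by (simp only: of_nat_le_iff[where 'a = real, symmetric]) simp
next
  case False
  have "q < 2 ^ q" by (rule less_exp)
  moreover have "m < q" using False by (simp add: h_def)
  ultimately show ?thesis by linarith
qed

theorem theorem2:
  "\<exists>(P :: nat \<Rightarrow> nat pmf set) (\<epsilon> :: real). label_invariant P \<and> \<epsilon> > 0 \<and>
     (\<exists>(c :: real) > 0. \<exists>(k :: nat) (N :: nat). \<forall>n \<ge> N. \<forall>q t.
        queries_le n q t \<longrightarrow> tests_property n (P n) \<epsilon> t \<longrightarrow>
        real q \<ge> c * ln (ln (real n)) / (ln (ln (ln (real n)))) ^ k)"
proof -
  \<comment> \<open>All scales must fit below \<open>n\<close>, which needs
    \<open>(m + 1) * 3 * ln (12 * (m + 1)) \<le> ln n\<close>. The square root leaves ample room and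
    only halves the leading term of \<open>ln m\<close>.\<close>
  define m where "m n = nat \<lfloor>sqrt (ln (real n))\<rfloor>" for n
  define g where "g n = (12 * Suc (m n)) ^ 3" for n
  have "eventually (\<lambda>n::nat. (sqrt (ln n) + 1) * (3 * ln (12 * (sqrt (ln n) + 1))) \<le> ln n)
      sequentially"
    by real_asymp
  \<comment> \<open>The right-hand side grows like \<open>ln (ln n) / 2\<close>; settling for a
    quarter absorbs the constants.\<close>
  moreover have "eventually (\<lambda>n::nat. ln (ln n) / 4 \<le> ln ((sqrt (ln n) - 1) / 18)) sequentially"
    by real_asymp
  moreover have "eventually (\<lambda>n::nat. 1 < sqrt (ln n) \<and> 0 < n) sequentially"
    by (intro eventually_conj; real_asymp)
  ultimately have "eventually (\<lambda>n::nat. (sqrt (ln n) + 1) * (3 * ln (12 * (sqrt (ln n) + 1)))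
      \<le> ln n \<and> ln (ln n) / 4 \<le> ln ((sqrt (ln n) - 1) / 18) \<and> 1 < sqrt (ln n) \<and> 0 < n) sequentially"
    by eventually_elim auto
  then obtain N :: nat where N: "\<And>n::nat. n \<ge> N \<Longrightarrow> (sqrt (ln n) + 1) * (3 * ln (12 * (sqrt (ln n) + 1)))
      \<le> ln n \<and> ln (ln n) / 4 \<le> ln ((sqrt (ln n) - 1) / 18) \<and> 1 < sqrt (ln n) \<and> 0 < n"
    by (auto simp: eventually_sequentially)
  have bound: "ln (ln (real n)) / 4 \<le> real q"
    if "n \<ge> N" "queries_le n q t" "tests_property n (even_scale_uniform (g n) n) (1/4) t" for n q t
  proof -
    define s where "s = sqrt (ln (real n))"
    have s: "(s + 1) * (3 * ln (12 * (s + 1))) \<le> ln n"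
      "ln (ln n) / 4 \<le> ln ((s - 1) / 18)" "1 < s" "0 < n"
      using N[OF that(1)] by (auto simp: s_def)
    have m: "s - 1 \<le> m n" "m n \<le> s"
      using s(3) unfolding m_def s_def[symmetric] by linarith+
    have "ln (real (g n ^ Suc (m n))) = real (Suc (m n)) * (3 * ln (12 * real (Suc (m n))))"
      unfolding g_def by (simp only: of_nat_power of_nat_mult of_nat_numeral)
        (simp only: ln_realpow zero_less_power of_nat_numeral)
    also have "\<dots> \<le> (s + 1) * (3 * ln (12 * (s + 1)))"
      using m s(3) by (intro mult_mono mult_left_mono) auto
    also have "\<dots> \<le> ln n" by (rule s)
    finally have "real (g n ^ Suc (m n)) \<le> real n"
      using s(4) by (subst (asm) ln_le_cancel_iff) (auto simp: g_def)
    then have "g n ^ Suc (m n) \<le> n" by (simp only: of_nat_le_iff)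
    then have "m n \<le> 18 * 2 ^ q"
      using query_lower_bound that(2,3) unfolding g_def by blast
    then have "real (m n) \<le> real (18 * 2 ^ q)" by (simp only: of_nat_le_iff)
    then have "(s - 1) / 18 \<le> 2 ^ q" using m by simp
    then have "ln ((s - 1) / 18) \<le> ln (2 ^ q)" using s(3) by (subst ln_le_cancel_iff) auto
    also have "\<dots> = q * ln 2" by (simp add: ln_realpow)
    also have "\<dots> \<le> real q * 1" using ln_2_less_1 by (intro mult_left_mono) auto
    finally show ?thesis using s(2) by simp
  qed
  have "label_invariant (\<lambda>n. even_scale_uniform (g n) n)"
    by (rule label_invariant_even_scale_uniform)
  \<comment> \<open>Exponent 0 makes the denominator 1, so the bound is a pure multiple of
    \<open>ln (ln n)\<close>.\<close>
  moreover have "\<forall>n\<ge>N. \<forall>q t. queries_le n q t \<longrightarrow>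
      tests_property n (even_scale_uniform (g n) n) (1/4) t \<longrightarrow>
      real q \<ge> 1/4 * ln (ln (real n)) / (ln (ln (ln (real n)))) ^ 0"
    using bound by simp
  ultimately show ?thesis
    by (intro exI[of _ "\<lambda>n. even_scale_uniform (g n) n"] exI[of _ "1/4 :: real"] conjI
        exI[of _ "0 :: nat"] exI[of _ N]) auto
qed

end
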